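(* Let $E=\{1,\ldots,s\}$, $T>0$, $h>0$, $t_m=mh$. Let the entries of $A=(A_{ij})_{i,j\in E}$ be right-continuous functions of bounded variation with $A(0)=O_s$, and let the entries of $B=(B_{ij})_{i,j\in E}$ be Borel measurable and bounded on compact intervals. Suppose that every $A_{ir}$ is absolutely continuous with density $a_{ir}\in C^1([0,T])$ and that every $B_{rj}$ belongs to $C^2([0,T])$. Let $E_d(m)=[A\star B](t_m)-[\Delta A*B_2](m)$. Then, for $t_m\le T$, $$\|E_d(m)\|_F\le s^2Th^2\left(\frac{M_{A,1}M_{B,1}}{12}+\frac{M_{A,0}M_{B,2}}{4}\right),$$ where $M_{A,0}=\max_{i,r}\|a_{ir}\|_\infty$, $M_{A,1}=\max_{i,r}\|a_{ir}'\|_\infty$, $M_{B,1}=\max_{r,j}\|B_{rj}'\|_\infty$, $M_{B,2}=\max_{r,j}\|B_{rj}''\|_\infty$, the sup norms being over $[0,T]$.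
   Context: Functions are defined on $[0,\infty)$. The matrix Stieltjes convolution (Lebesgue–Stieltjes sense) is $[A\star B]_{ij}(t)=\sum_{r\in E}\int_{[0,t]}B_{rj}(t-x)\,dA_{ir}(x)$. Discretization: $\Delta A(0)=O_s$ (the $s\times s$ zero matrix), $\Delta A(m)=A(t_m)-A(t_{m-1})$ for $m\ge1$, $B_2(m)=\tfrac12\bigl(B(t_{m+1})+B(t_m)\bigr)$, and $[\Delta A*B_2](m)=\sum_{\ell=0}^m\Delta A(\ell)B_2(m-\ell)$. $\|\cdot\|_F$ is the Frobenius norm. *)

theory Defs
  imports "HOL-Analysis.Analysis"
begin

definition variation_sums :: "(real \<Rightarrow> real) \<Rightarrow> real \<Rightarrow> real \<Rightarrow> real set" where
  "variation_sums f a b =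
     {\<Sum>k<n. \<bar>f (u (Suc k)) - f (u k)\<bar> | (n::nat) (u::nat \<Rightarrow> real).
        mono u \<and> range u \<subseteq> {a..b}}"

definition bounded_variation_on :: "(real \<Rightarrow> real) \<Rightarrow> real \<Rightarrow> real \<Rightarrow> bool" where
  "bounded_variation_on f a b \<longleftrightarrow> bdd_above (variation_sums f a b)"

definition total_variation :: "(real \<Rightarrow> real) \<Rightarrow> real \<Rightarrow> real \<Rightarrow> real" where
  "total_variation f a b = Sup (variation_sums f a b)"

text \<open>
  Jordan decomposition of a function on \<open>[0,\<infinity>)\<close>, extended by \<open>0\<close> to the negative
  half-line.  The associated Lebesgue-Stieltjes measure therefore has an atom of mass \<open>F 0\<close>
  at \<open>0\<close>, which is no atom if \<open>F 0 = 0\<close>.  For \<open>F\<close> right-continuous and of bounded variation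
  on compact intervals, both parts are nondecreasing and right-continuous on the whole line, as
  \<^const>\<open>interval_measure\<close> requires, and their difference is \<open>F\<close> on \<open>[0,\<infinity>)\<close>.
\<close>

definition pos_variation :: "(real \<Rightarrow> real) \<Rightarrow> real \<Rightarrow> real" where
  "pos_variation F x = (if x < 0 then 0 else (\<bar>F 0\<bar> + total_variation F 0 x + F x) / 2)"

definition neg_variation :: "(real \<Rightarrow> real) \<Rightarrow> real \<Rightarrow> real" where
  "neg_variation F x = (if x < 0 then 0 else (\<bar>F 0\<bar> + total_variation F 0 x - F x) / 2)"

definition stieltjes_integral :: "(real \<Rightarrow> real) \<Rightarrow> real set \<Rightarrow> (real \<Rightarrow> real) \<Rightarrow> real" where
  "stieltjes_integral F S g =
     (LINT x:S|interval_measure (pos_variation F). g x)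
     - (LINT x:S|interval_measure (neg_variation F). g x)"

definition stieltjes_conv ::
    "(real \<Rightarrow> real^'n^'n) \<Rightarrow> (real \<Rightarrow> real^'n^'n) \<Rightarrow> real \<Rightarrow> real^('n::finite)^'n" where
  "stieltjes_conv A B t =
     (\<chi> i j. \<Sum>r\<in>UNIV. stieltjes_integral (\<lambda>x. A x $ i $ r) {0..t} (\<lambda>x. B (t - x) $ r $ j))"

definition grid :: "real \<Rightarrow> nat \<Rightarrow> real" where
  "grid h m = real m * h"

definition grid_increment :: "real \<Rightarrow> (real \<Rightarrow> real^'n^'n) \<Rightarrow> nat \<Rightarrow> real^('n::finite)^'n" where
  "grid_increment h A m = (if m = 0 then 0 else A (grid h m) - A (grid h (m - 1)))"

definition grid_average :: "real \<Rightarrow> (real \<Rightarrow> real^'n^'n) \<Rightarrow> nat \<Rightarrow> real^('n::finite)^'n" where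
  "grid_average h B m = (1/2) *\<^sub>R (B (grid h (m + 1)) + B (grid h m))"

definition discrete_conv ::
    "(nat \<Rightarrow> real^'n^'n) \<Rightarrow> (nat \<Rightarrow> real^'n^'n) \<Rightarrow> nat \<Rightarrow> real^('n::finite)^'n" where
  "discrete_conv X Y m = (\<Sum>l=0..m. X l ** Y (m - l))"

definition discretization_error ::
    "real \<Rightarrow> (real \<Rightarrow> real^'n^'n) \<Rightarrow> (real \<Rightarrow> real^'n^'n) \<Rightarrow> nat \<Rightarrow> real^('n::finite)^'n" where
  "discretization_error h A B m =
     stieltjes_conv A B (grid h m) - discrete_conv (grid_increment h A) (grid_average h B) m"

definition frobenius_norm :: "real^'n^'n \<Rightarrow> real" where
  "frobenius_norm X = sqrt (\<Sum>i\<in>UNIV. \<Sum>j\<in>UNIV. (X $ i $ j)\<^sup>2)"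

definition abs_continuous_with_density ::
    "real \<Rightarrow> (real \<Rightarrow> real) \<Rightarrow> (real \<Rightarrow> real) \<Rightarrow> bool" where
  "abs_continuous_with_density T F f \<longleftrightarrow>
     set_integrable lborel {0..T} f \<and> (\<forall>t\<in>{0..T}. F t = F 0 + (LINT x:{0..t}|lborel. f x))"

text \<open>Derivatives are taken relative to \<open>S\<close>, hence one-sided at the endpoints of an interval.\<close>

primrec nth_deriv_within :: "real set \<Rightarrow> nat \<Rightarrow> (real \<Rightarrow> real) \<Rightarrow> real \<Rightarrow> real" where
  "nth_deriv_within S 0 f = f"
| "nth_deriv_within S (Suc k) f =
     (\<lambda>x. vector_derivative (nth_deriv_within S k f) (at x within S))"

definition Ck_on :: "nat \<Rightarrow> real set \<Rightarrow> (real \<Rightarrow> real) \<Rightarrow> bool" where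
  "Ck_on k S f \<longleftrightarrow>
     (\<forall>l<k. nth_deriv_within S l f differentiable_on S) \<and> continuous_on S (nth_deriv_within S k f)"

definition sup_norm_on :: "real set \<Rightarrow> (real \<Rightarrow> real) \<Rightarrow> real" where
  "sup_norm_on S f = (SUP x\<in>S. \<bar>f x\<bar>)"

definition max_deriv_norm :: "real \<Rightarrow> nat \<Rightarrow> (real \<Rightarrow> real^('n::finite)^'n) \<Rightarrow> real" where
  "max_deriv_norm T k F =
     Max {sup_norm_on {0..T} (nth_deriv_within {0..T} k (\<lambda>t. F t $ i $ j)) | i j. True}"

end

theory Submission
  imports Defs
begin

text \<open>The Jordan parts of a right-continuous function of bounded variation are right-continuous, so
  they induce genuine measures; comparing Riemann sums for the two measures and for the density
  identifies the Lebesgue-Stieltjes integral of a continuous function against \<open>F\<close> with its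
  integral against the density of \<open>F\<close>.  The error then splits into one term per grid cell, and a
  Taylor expansion of the kernel about the midpoint bounds each of them by
  \<open>h\<^sup>3 (M\<^sub>A\<^sub>,\<^sub>1 M\<^sub>B\<^sub>,\<^sub>1 / 12 + M\<^sub>A\<^sub>,\<^sub>0 M\<^sub>B\<^sub>,\<^sub>2 / 4)\<close>.\<close>

section \<open>Total variation\<close>

text \<open>The obstacle is that the integral is defined through the two Jordan parts separately,
  while the density belongs only to their difference; a density for each part would first require
  absolute continuity of the total variation itself. Riemann sums avoid this. They see a measure
  only through its masses on half-open cells \<open>{x<..y}\<close>, and for a continuous integrand
  the sums for the two parts converge separately. The difference of these sums is, for every number
  of cells, exactly the sum built from the integrals of the density. Monotonicity and
  right-continuity of the parts are what makes \<open>interval_measure\<close> assign to such a cell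
  the increment of the part.\<close>

lemma sum_le_total_variation:
  assumes "bounded_variation_on f a b" "mono u" "range u \<subseteq> {a..b}"
  shows "(\<Sum>k<n. \<bar>f (u (Suc k)) - f (u k)\<bar>) \<le> total_variation f a b"
  using assms unfolding total_variation_def bounded_variation_on_def
  by (intro cSup_upper) (auto simp: variation_sums_def)

lemma total_variation_least:
  assumes "a \<le> b"
    and "\<And>n u. mono u \<Longrightarrow> range u \<subseteq> {a..b} \<Longrightarrow> (\<Sum>k<n. \<bar>f (u (Suc k)) - f (u k)\<bar>) \<le> c"
  shows "total_variation f a b \<le> c"
proof -
  \<comment> \<open>A real \<open>Sup\<close> is a least upper bound only for a nonempty set; the
    empty sum along a constant chain provides a member.\<close>
  have "0 \<in> variation_sums f a b"
    unfolding variation_sums_def using \<open>a \<le> b\<close>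
    by (auto simp: monotone_def intro!: exI[of _ "0::nat"] exI[of _ "\<lambda>_. a"])
  then show ?thesis
    unfolding total_variation_def using assms(2)
    by (intro cSup_least) (auto simp: variation_sums_def)
qed

lemma total_variation_refl [simp]: "total_variation f a a = 0"
proof -
  have "variation_sums f a a = {0}"
  proof (intro set_eqI iffI)
    fix v assume "v \<in> variation_sums f a a"
    then obtain n and u :: "nat \<Rightarrow> real"
      where v: "v = (\<Sum>k<n. \<bar>f (u (Suc k)) - f (u k)\<bar>)" and "range u \<subseteq> {a..a}"
      unfolding variation_sums_def by blast
    then have "u k = a" for k by auto
    with v show "v \<in> {0}" by simp
  next
    fix v :: real assume "v \<in> {0}"
    then show "v \<in> variation_sums f a a"
      unfolding variation_sums_def
      by (auto simp: monotone_def intro!: exI[of _ "0::nat"] exI[of _ "\<lambda>_. a"])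
  qed
  then show ?thesis by (simp add: total_variation_def)
qed

lemma variation_sums_uminus: "variation_sums (\<lambda>x. - f x) a b = variation_sums f a b"
  unfolding variation_sums_def by (simp add: abs_minus_commute)

lemma bounded_variation_on_uminus:
  "bounded_variation_on (\<lambda>x. - f x) a b \<longleftrightarrow> bounded_variation_on f a b"
  by (simp add: bounded_variation_on_def variation_sums_uminus)

text \<open>A sign change leaves the total variation alone, so every fact about the positive part
  transfers to the negative one by passing to \<open>- F\<close>.\<close>

lemma neg_variation_eq: "neg_variation F = pos_variation (\<lambda>x. - F x)"
  by (auto simp: neg_variation_def pos_variation_def total_variation_def variation_sums_uminus)

lemma sum_lessThan_add: "(\<Sum>k<p + q. g k) = (\<Sum>k<p. g k) + (\<Sum>k<q. g (p + k :: nat) :: real)"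
  by (induction q) auto

text \<open>Appending a chain in \<open>{b..c}\<close> to one in \<open>{a..b}\<close> gives a chain
  in \<open>{a..c}\<close>. The second chain stays fixed while the supremum is taken over the first;
  in this form the lemma covers both a two-point chain and a clipped partition.\<close>

lemma total_variation_superadditive:
  assumes bv: "bounded_variation_on f a c" and "a \<le> b" "b \<le> c"
    and w: "mono w" "range w \<subseteq> {b..c}"
  shows "total_variation f a b + (\<Sum>k<n. \<bar>f (w (Suc k)) - f (w k)\<bar>) \<le> total_variation f a c"
proof -
  have "total_variation f a b \<le> total_variation f a c - (\<Sum>k<n. \<bar>f (w (Suc k)) - f (w k)\<bar>)"
  proof (rule total_variation_least[OF \<open>a \<le> b\<close>])
    fix p and v :: "nat \<Rightarrow> real" assume v: "mono v" "range v \<subseteq> {a..b}"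
    \<comment> \<open>Index \<open>p\<close> is the last point of \<open>v\<close> that the sum uses
      and \<open>Suc p\<close> the first of \<open>w\<close>. The joining term between them is
      nonnegative and is dropped, hence \<open>Suc p + n\<close> terms below.\<close>
    define z where "z k = (if k \<le> p then v k else w (k - Suc p))" for k
    have vw: "v i \<le> w j" for i j
      using v(2) w(2) by (meson atLeastAtMost_iff order_trans range_subsetD)
    have "mono z"
      unfolding z_def monotone_def using v(1) w(1) vw by (auto simp: monoD)
    moreover have "range z \<subseteq> {a..c}"
    proof (rule image_subsetI)
      fix k
      have "v k \<in> {a..b}" "w (k - Suc p) \<in> {b..c}" using v(2) w(2) by (blast intro: rangeI)+
      then show "z k \<in> {a..c}" using \<open>a \<le> b\<close> \<open>b \<le> c\<close> by (simp add: z_def)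
    qed
    ultimately have "(\<Sum>k<Suc p + n. \<bar>f (z (Suc k)) - f (z k)\<bar>) \<le> total_variation f a c"
      using bv by (rule sum_le_total_variation[rotated])
    moreover have "(\<Sum>k<p. \<bar>f (z (Suc k)) - f (z k)\<bar>) = (\<Sum>k<p. \<bar>f (v (Suc k)) - f (v k)\<bar>)"
      by (intro sum.cong) (auto simp: z_def)
    moreover have "(\<Sum>k<n. \<bar>f (z (Suc (Suc p + k))) - f (z (Suc p + k))\<bar>)
        = (\<Sum>k<n. \<bar>f (w (Suc k)) - f (w k)\<bar>)"
      by (intro sum.cong) (auto simp: z_def)
    ultimately show "(\<Sum>k<p. \<bar>f (v (Suc k)) - f (v k)\<bar>)
        \<le> total_variation f a c - (\<Sum>k<n. \<bar>f (w (Suc k)) - f (w k)\<bar>)"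
      unfolding sum_lessThan_add[of _ "Suc p" n] by simp
  qed
  then show ?thesis by simp
qed

lemma total_variation_increment:
  assumes "bounded_variation_on f a c" "a \<le> b" "b \<le> c"
  shows "total_variation f a b + \<bar>f c - f b\<bar> \<le> total_variation f a c"
proof -
  have "mono (\<lambda>k::nat. if k = 0 then b else c)" using assms by (auto simp: monotone_def)
  moreover have "range (\<lambda>k::nat. if k = 0 then b else c) \<subseteq> {b..c}" using assms by auto
  ultimately show ?thesis
    using total_variation_superadditive[OF assms, of "\<lambda>k. if k = 0 then b else c" 1] by simp
qed

text \<open>Take a partition of \<open>{a..d}\<close> that almost attains the total variation and insert \<open>c\<close> and
  \<open>x\<close>, where \<open>x\<close> is so close to \<open>c\<close> that no partition point lies strictly between them: the
  variation on \<open>{c..x}\<close> is then at most \<open>\<bar>f x - f c\<bar>\<close> plus the defect of the partition.\<close>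

lemma total_variation_right_continuous:
  assumes bv: "bounded_variation_on f a d" and "a \<le> c" "c < d"
    and cont: "continuous (at_right c) f"
  shows "(total_variation f a \<longlongrightarrow> total_variation f a c) (at_right c)"
proof (rule tendstoI)
  fix e :: real assume "e > 0"
  let ?V = "total_variation f a"
  have "\<exists>n u. mono u \<and> range u \<subseteq> {a..d} \<and> ?V d - e/2 < (\<Sum>k<n. \<bar>f (u (Suc k)) - f (u k)\<bar>)"
  proof (rule ccontr)
    assume "\<not> ?thesis"
    then have "?V d \<le> ?V d - e/2"
      using \<open>a \<le> c\<close> \<open>c < d\<close> by (intro total_variation_least) (auto simp: not_less)
    with \<open>e > 0\<close> show False by simp
  qed
  then obtain n and u :: "nat \<Rightarrow> real" where u: "mono u" "range u \<subseteq> {a..d}"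
    and n: "?V d - e/2 < (\<Sum>k<n. \<bar>f (u (Suc k)) - f (u k)\<bar>)" by blast
  have "eventually (\<lambda>x. dist (f x) (f c) < e/2) (at_right c)"
    using cont \<open>e > 0\<close> by (intro tendstoD) (auto simp: continuous_within)
  moreover have "eventually (\<lambda>x. c < x) (at_right c)"
    by (rule eventually_at_right_less)
  moreover have "eventually (\<lambda>x. x < d) (at_right c)"
    using \<open>c < d\<close> by (rule order_tendstoD(2)[OF tendsto_ident_at])
  \<comment> \<open>Only the finitely many nodes with index up to \<open>n\<close> occur in the sum,
    so some right neighbourhood of \<open>c\<close> avoids all those beyond
    \<open>c\<close>.\<close>
  moreover have "eventually (\<lambda>x. \<forall>k\<in>{..n}. c < u k \<longrightarrow> x < u k) (at_right c)"
  proof (intro eventually_ball_finite ballI)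
    fix k
    show "eventually (\<lambda>x. c < u k \<longrightarrow> x < u k) (at_right c)"
      using order_tendstoD(2)[OF tendsto_ident_at, of c "u k" "{c<..}"]
      by (cases "c < u k") auto
  qed simp
  ultimately show "eventually (\<lambda>x. dist (?V x) (?V c) < e) (at_right c)"
  proof eventually_elim
    case (elim x)
    then have fx: "\<bar>f x - f c\<bar> < e/2" and "c < x" "x < d" by (auto simp: dist_real_def)
    have gap: "x < u k" if "k \<le> n" "c < u k" for k using elim that by simp
    have ud: "a \<le> u k" "u k \<le> d" for k using u(2) by (auto simp: subset_iff)
    have bv': "bounded_variation_on f a y" if "y \<le> d" for y
    proof -
      have "variation_sums f a y \<subseteq> variation_sums f a d"
      proof
        fix v assume "v \<in> variation_sums f a y"
        moreover have "{a..y} \<subseteq> {a..d}" using that by simp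
        ultimately show "v \<in> variation_sums f a d"
          unfolding variation_sums_def by (blast intro: order_trans)
      qed
      then show ?thesis
        using bv unfolding bounded_variation_on_def by (rule bdd_above_mono[rotated])
    qed
    \<comment> \<open>\<open>s\<close> jumps from 0 to 1 where the chain crosses \<open>c\<close>.
      Its increments telescope to at most 1, so the price \<bar>f x - f c\<bar> of the inserted
      piece is paid at most once. The other two terms are the chain clipped to \<open>{a..c}\<close>
      and to \<open>{x..d}\<close>.\<close>
    define s :: "nat \<Rightarrow> real" where "s k = (if u k \<le> c then 0 else 1)" for k
    have "\<bar>f (u (Suc k)) - f (u k)\<bar> \<le>
        \<bar>f (min (u (Suc k)) c) - f (min (u k) c)\<bar> + \<bar>f x - f c\<bar> * (s (Suc k) - s k)
        + \<bar>f (max (u (Suc k)) x) - f (max (u k) x)\<bar>" if "k < n" for k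
    proof -
      have uk: "u k \<le> u (Suc k)" using u(1) by (simp add: monoD)
      consider "u (Suc k) \<le> c" | "u k \<le> c" "c < u (Suc k)" | "c < u k" by linarith
      then show ?thesis
      proof cases
        case 1
        then show ?thesis using uk \<open>c < x\<close> by (simp add: s_def max_def min_def)
      next
        case 2
        then have "x < u (Suc k)" using gap that by simp
        with 2 \<open>c < x\<close> show ?thesis by (simp add: s_def max_def min_def)
      next
        case 3
        then have "x < u k" "x < u (Suc k)" using gap[of k] that uk by auto
        with 3 \<open>c < x\<close> show ?thesis by (simp add: s_def max_def min_def)
      qed
    qed
    then have "(\<Sum>k<n. \<bar>f (u (Suc k)) - f (u k)\<bar>) \<le>
        (\<Sum>k<n. \<bar>f (min (u (Suc k)) c) - f (min (u k) c)\<bar> + \<bar>f x - f c\<bar> * (s (Suc k) - s k)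
        + \<bar>f (max (u (Suc k)) x) - f (max (u k) x)\<bar>)"
      by (intro sum_mono) simp
    also have "\<dots> = (\<Sum>k<n. \<bar>f (min (u (Suc k)) c) - f (min (u k) c)\<bar>) + \<bar>f x - f c\<bar> * (s n - s 0)
        + (\<Sum>k<n. \<bar>f (max (u (Suc k)) x) - f (max (u k) x)\<bar>)"
      by (simp add: sum.distrib sum_lessThan_telescope flip: sum_distrib_left)
    also have "\<dots> \<le> ?V c + \<bar>f x - f c\<bar> + (?V d - ?V x)"
    proof (intro add_mono)
      show "(\<Sum>k<n. \<bar>f (min (u (Suc k)) c) - f (min (u k) c)\<bar>) \<le> ?V c"
        using u(1) ud \<open>a \<le> c\<close> \<open>c < d\<close>
        by (intro sum_le_total_variation bv' monoI min.mono) (auto simp: monoD)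
      have "\<bar>f x - f c\<bar> * (s n - s 0) \<le> \<bar>f x - f c\<bar> * 1"
        by (intro mult_left_mono) (auto simp: s_def)
      then show "\<bar>f x - f c\<bar> * (s n - s 0) \<le> \<bar>f x - f c\<bar>" by simp
      have "?V x + (\<Sum>k<n. \<bar>f (max (u (Suc k)) x) - f (max (u k) x)\<bar>) \<le> ?V d"
        using u(1) ud \<open>a \<le> c\<close> \<open>c < x\<close> \<open>x < d\<close>
        by (intro total_variation_superadditive bv monoI max.mono) (auto simp: monoD)
      then show "(\<Sum>k<n. \<bar>f (max (u (Suc k)) x) - f (max (u k) x)\<bar>) \<le> ?V d - ?V x" by simp
    qed
    \<comment> \<open>\<open>?V d\<close> cancels: one half of \<open>e\<close> is the defect of the
      partition, the other bounds \<bar>f x - f c\<bar>.\<close>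
    finally have "?V x < ?V c + e" using n fx by linarith
    moreover have "?V c \<le> ?V x"
      using total_variation_increment[of f a x c] bv' \<open>a \<le> c\<close> \<open>c < x\<close> \<open>x < d\<close> by fastforce
    ultimately show ?case by (simp add: dist_real_def)
  qed
qed

section \<open>Jordan parts as distribution functions of measures\<close>

lemma pos_variation_mono:
  assumes "\<And>b. 0 \<le> b \<Longrightarrow> bounded_variation_on F 0 b" and "x \<le> y"
  shows "pos_variation F x \<le> pos_variation F y"
proof -
  \<comment> \<open>This serves the passage from the negative half-line, where the part is 0:
    together with the summand |F 0| it makes the value at \<open>y\<close> nonnegative.\<close>
  have "\<bar>F y - F 0\<bar> \<le> total_variation F 0 y" if "0 \<le> y" for y
    using total_variation_increment[of F 0 y 0] assms(1) that by simp
  note y = this[of y]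
  have xy: "total_variation F 0 x + \<bar>F y - F x\<bar> \<le> total_variation F 0 y" if "0 \<le> x"
    using total_variation_increment[of F 0 y x] assms that by simp
  consider "y < 0" | "x < 0" "0 \<le> y" | "0 \<le> x" by linarith
  then show ?thesis
  proof cases
    case 2
    with y show ?thesis by (simp add: pos_variation_def)
  next
    case 3
    with xy have "total_variation F 0 x + F x \<le> total_variation F 0 y + F y" by linarith
    with 3 \<open>x \<le> y\<close> show ?thesis by (simp add: pos_variation_def)
  qed (use \<open>x \<le> y\<close> in \<open>simp add: pos_variation_def\<close>)
qed

text \<open>A jump at 0 does no harm, since to the right of a negative \<open>t\<close> the function
  is locally 0. For the other \<open>t\<close> the interval \<open>{0..t + 1}\<close> gives the room
  to the right that the continuity of the total variation asks for.\<close>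

lemma pos_variation_right_continuous:
  assumes bv: "\<And>b. 0 \<le> b \<Longrightarrow> bounded_variation_on F 0 b"
    and cont: "\<And>t. 0 \<le> t \<Longrightarrow> continuous (at_right t) F"
  shows "continuous (at_right t) (pos_variation F)"
proof (cases "t < 0")
  case True
  then have "eventually (\<lambda>x. x < 0) (at_right t)"
    by (rule order_tendstoD(2)[OF tendsto_ident_at])
  then have "eventually (\<lambda>x. pos_variation F x = 0) (at_right t)"
    by eventually_elim (simp add: pos_variation_def)
  with True show ?thesis
    unfolding continuous_within by (simp add: pos_variation_def tendsto_eventually)
next
  case False
  have "((\<lambda>x. (\<bar>F 0\<bar> + total_variation F 0 x + F x) / 2)
      \<longlongrightarrow> (\<bar>F 0\<bar> + total_variation F 0 t + F t) / 2) (at_right t)"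
    using False total_variation_right_continuous[OF bv, of "t + 1" t] cont[of t]
    by (intro tendsto_intros) (auto simp: continuous_within)
  moreover have "eventually (\<lambda>x. pos_variation F x = (\<bar>F 0\<bar> + total_variation F 0 x + F x) / 2) (at_right t)"
    using eventually_at_right_less[of t] by eventually_elim (use False in \<open>simp add: pos_variation_def\<close>)
  ultimately have "(pos_variation F \<longlongrightarrow> (\<bar>F 0\<bar> + total_variation F 0 t + F t) / 2) (at_right t)"
    by (rule tendsto_cong[THEN iffD2, rotated])
  with False show ?thesis
    unfolding continuous_within by (simp add: pos_variation_def)
qed

lemma emeasure_pos_variation_Ioc:
  assumes "\<And>b. 0 \<le> b \<Longrightarrow> bounded_variation_on F 0 b"
    and "\<And>t. 0 \<le> t \<Longrightarrow> continuous (at_right t) F" and "a \<le> b"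
  shows "emeasure (interval_measure (pos_variation F)) {a<..b}
    = ennreal (pos_variation F b - pos_variation F a)"
  using assms
  by (intro emeasure_interval_measure_Ioc pos_variation_mono pos_variation_right_continuous)

section \<open>Riemann sums for Lebesgue-Stieltjes integrals\<close>

lemma set_integrable_continuous_mult:
  fixes g w :: "real \<Rightarrow> real"
  assumes M: "sets M = sets borel" and g: "continuous_on {a..b} g"
    and w: "set_integrable M {a<..b} w"
  shows "set_integrable M {a<..b} (\<lambda>x. g x * w x)"
proof -
  have "bounded (g ` {a..b})"
    using g by (intro compact_imp_bounded compact_continuous_image) auto
  then obtain C where C: "\<forall>x\<in>{a..b}. \<bar>g x\<bar> \<le> C"
    unfolding bounded_iff by auto
  \<comment> \<open>Nothing is known about \<open>g\<close> off \<open>{a..b}\<close>, so it is cut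
    off there before measurability is claimed. The closed interval provides compactness, the
    half-open one fits the cells of the measure, and the product of the two indicators is the
    smaller one.\<close>
  have "(\<lambda>x. indicator {a..b} x *\<^sub>R g x) \<in> borel_measurable M"
    using borel_measurable_continuous_on_indicator[OF _ g] M by (simp cong: measurable_cong_sets)
  then have "(\<lambda>x. (indicator {a..b} x *\<^sub>R g x) * (indicator {a<..b} x *\<^sub>R w x)) \<in> borel_measurable M"
    using w unfolding set_integrable_def by (intro borel_measurable_times) auto
  also have "(\<lambda>x. (indicator {a..b} x *\<^sub>R g x) * (indicator {a<..b} x *\<^sub>R w x))
      = (\<lambda>x. indicator {a<..b} x *\<^sub>R (g x * w x))"
    by (auto simp: indicator_def)
  finally have meas: "(\<lambda>x. indicator {a<..b} x *\<^sub>R (g x * w x)) \<in> borel_measurable M" .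
  have "integrable M (\<lambda>x. C * (indicator {a<..b} x *\<^sub>R w x))"
    using w unfolding set_integrable_def by simp
  then show ?thesis
    unfolding set_integrable_def using meas
  proof (rule Bochner_Integration.integrable_bound)
    show "AE x in M. norm (indicator {a<..b} x *\<^sub>R (g x * w x)) \<le> norm (C * (indicator {a<..b} x *\<^sub>R w x))"
    proof (rule AE_I2)
      fix x
      show "norm (indicator {a<..b} x *\<^sub>R (g x * w x)) \<le> norm (C * (indicator {a<..b} x *\<^sub>R w x))"
        using C order_trans[OF _ abs_ge_self[of C]]
        by (cases "x \<in> {a<..b}") (auto simp: abs_mult intro!: mult_right_mono)
    qed
  qed
qed

text \<open>Half-open cells are disjoint and fit together without gaps, so the splitting is exact
  even if the measure has atoms at the nodes.\<close>

lemma set_integral_Ioc_sum: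
  fixes f :: "real \<Rightarrow> real" and u :: "nat \<Rightarrow> real"
  assumes M: "sets M = sets borel" and u: "mono u" and f: "set_integrable M {u 0<..u n} f"
  shows "(LINT x:{u 0<..u n}|M. f x) = (\<Sum>k<n. LINT x:{u k<..u (Suc k)}|M. f x)"
  using f
proof (induction n)
  case 0
  then show ?case by (simp add: set_lebesgue_integral_def)
next
  case (Suc n)
  have un: "u 0 \<le> u n" "u n \<le> u (Suc n)" using u by (simp_all add: monoD)
  have sets: "{u i<..u j} \<in> sets M" for i j using M by simp
  have "{u 0<..u n} \<subseteq> {u 0<..u (Suc n)}" "{u n<..u (Suc n)} \<subseteq> {u 0<..u (Suc n)}"
    using un by (simp_all add: Ioc_subset_iff)
  note int = this[THEN set_integrable_subset[OF Suc.prems sets]]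
  have "(LINT x:{u 0<..u (Suc n)}|M. f x) = (LINT x:{u 0<..u n} \<union> {u n<..u (Suc n)}|M. f x)"
    by (simp only: ivl_disj_un_two(6)[OF un])
  also have "\<dots> = (LINT x:{u 0<..u n}|M. f x) + (LINT x:{u n<..u (Suc n)}|M. f x)"
    by (rule set_integral_Un[OF _ int]) (simp add: ivl_disj_int_two)
  finally show ?case by (simp only: Suc.IH[OF int(1)] sum.lessThan_Suc)
qed

lemma set_integral_abs_le:
  fixes f g :: "'a \<Rightarrow> real"
  assumes "set_integrable M S f" "set_integrable M S g" "\<And>x. x \<in> S \<Longrightarrow> \<bar>f x\<bar> \<le> g x"
  shows "\<bar>LINT x:S|M. f x\<bar> \<le> (LINT x:S|M. g x)"
proof -
  have "\<bar>LINT x:S|M. f x\<bar> \<le> (LINT x:S|M. \<bar>f x\<bar>)"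
    using set_integral_norm_bound[OF assms(1)] by simp
  also have "\<dots> \<le> (LINT x:S|M. g x)"
    using assms by (intro set_integral_mono set_integrable_abs)
  finally show ?thesis .
qed

text \<open>For \<open>n = 0\<close> division by zero sends every node to \<open>a\<close>;
  monotonicity then holds for all \<open>n\<close>, and only the right end point asks for
  \<open>0 < n\<close>.\<close>

definition uniform_node :: "real \<Rightarrow> real \<Rightarrow> nat \<Rightarrow> nat \<Rightarrow> real" where
  "uniform_node a b n k = a + (b - a) * real k / real n"

lemma mono_uniform_node: "a \<le> b \<Longrightarrow> mono (uniform_node a b n)"
  unfolding uniform_node_def by (intro monoI add_left_mono divide_right_mono mult_left_mono) auto

lemma uniform_node_ends:
  "uniform_node a b n 0 = a" "0 < n \<Longrightarrow> uniform_node a b n n = b"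
  by (simp_all add: uniform_node_def)

lemma uniform_node_in:
  assumes "a \<le> b" "0 < n" "k \<le> n"
  shows "uniform_node a b n k \<in> {a..b}"
  using monoD[OF mono_uniform_node[OF \<open>a \<le> b\<close>, of n], of 0 k]
    monoD[OF mono_uniform_node[OF \<open>a \<le> b\<close>, of n], of k n] assms
  by (simp add: uniform_node_ends)

text \<open>The measure and the weight are kept general so that one statement covers the Jordan
  measures with weight 1 and Lebesgue measure with the density as weight. Uniform continuity of
  \<open>g\<close> bounds the error on each cell by a small multiple of the integral of
  \<bar>w\<bar>.\<close>

lemma tendsto_Riemann_sums:
  fixes g w :: "real \<Rightarrow> real"
  assumes M: "sets M = sets borel" and "a \<le> b" and g: "continuous_on {a..b} g"
    and w: "set_integrable M {a<..b} w"
  shows "(\<lambda>n. \<Sum>k<n. g (uniform_node a b n (Suc k)) * (LINT x:{uniform_node a b n k<..uniform_node a b n (Suc k)}|M. w x))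
    \<longlonglongrightarrow> (LINT x:{a<..b}|M. g x * w x)"
proof (rule metric_LIMSEQ_I)
  fix e :: real assume "e > 0"
  define W where "W = (LINT x:{a<..b}|M. \<bar>w x\<bar>)"
  have "W \<ge> 0"
    unfolding W_def set_lebesgue_integral_def by (intro integral_nonneg_AE) auto
  \<comment> \<open>Adding 1 avoids division by zero when \<open>W\<close> vanishes and makes
    \<open>e' * W\<close> strictly smaller than \<open>e\<close>.\<close>
  define e' where "e' = e / (W + 1)"
  have "e' > 0" using \<open>e > 0\<close> \<open>W \<ge> 0\<close> by (simp add: e'_def)
  have "uniformly_continuous_on {a..b} g"
    using g by (intro compact_uniformly_continuous) auto
  then obtain d where "d > 0"
    and d: "\<And>x y. x \<in> {a..b} \<Longrightarrow> y \<in> {a..b} \<Longrightarrow> dist y x < d \<Longrightarrow> dist (g y) (g x) < e'"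
    using \<open>e' > 0\<close> unfolding uniformly_continuous_on_def by metis
  obtain N :: nat where N: "(b - a) / d < real N" using reals_Archimedean2 by blast
  show "\<exists>no. \<forall>n\<ge>no. dist (\<Sum>k<n. g (uniform_node a b n (Suc k)) * (LINT x:{uniform_node a b n k<..uniform_node a b n (Suc k)}|M. w x))
      (LINT x:{a<..b}|M. g x * w x) < e"
  proof (intro exI[of _ "Suc N"] allI impI)
    fix n assume "n \<ge> Suc N"
    then have n: "(b - a) / d < real n" "n > 0" using N by auto
    let ?p = "uniform_node a b n"
    note mono = mono_uniform_node[OF \<open>a \<le> b\<close>, of n]
    have p0: "?p 0 = a" and pn: "?p n = b" using n by (auto simp: uniform_node_ends)
    have step: "?p (Suc k) - ?p k < d" for k
    proof -
      have "?p (Suc k) - ?p k = (b - a) / real n"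
        using n by (simp add: uniform_node_def field_simps)
      also have "\<dots> < d" using n \<open>d > 0\<close> by (simp add: field_simps)
      finally show ?thesis .
    qed
    have pab: "?p k \<in> {a..b}" if "k \<le> n" for k
      using uniform_node_in \<open>a \<le> b\<close> n that by simp
    have sub: "{?p k<..?p (Suc k)} \<subseteq> {a<..b}" if "k < n" for k
      using pab[of k] pab[of "Suc k"] that by auto
    have gw: "set_integrable M {a<..b} (\<lambda>x. g x * w x)"
      using M g w by (rule set_integrable_continuous_mult)
    have int: "set_integrable M {?p k<..?p (Suc k)} w"
      "set_integrable M {?p k<..?p (Suc k)} (\<lambda>x. g x * w x)" if "k < n" for k
      using M by (simp_all add: set_integrable_subset[OF w _ sub[OF that]] set_integrable_subset[OF gw _ sub[OF that]])
    have cell: "\<bar>g (?p (Suc k)) * (LINT x:{?p k<..?p (Suc k)}|M. w x)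
        - (LINT x:{?p k<..?p (Suc k)}|M. g x * w x)\<bar> \<le> e' * (LINT x:{?p k<..?p (Suc k)}|M. \<bar>w x\<bar>)"
      if k: "k < n" for k
    proof -
      let ?I = "{?p k<..?p (Suc k)}"
      have "g (?p (Suc k)) * (LINT x:?I|M. w x) - (LINT x:?I|M. g x * w x)
          = (LINT x:?I|M. g (?p (Suc k)) * w x - g x * w x)"
        using set_integral_diff(2)[OF set_integrable_mult_right[OF int(1)[OF k]] int(2)[OF k], of "g (?p (Suc k))"]
        by simp
      also have "\<bar>\<dots>\<bar> \<le> (LINT x:?I|M. e' * \<bar>w x\<bar>)"
      proof (rule set_integral_abs_le)
        fix x assume x: "x \<in> ?I"
        have "dist (g (?p (Suc k))) (g x) < e'"
          using x sub[OF k] pab[of "Suc k"] k step[of k]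
          by (intro d) (auto simp: dist_real_def subset_iff)
        then have "\<bar>g (?p (Suc k)) - g x\<bar> * \<bar>w x\<bar> \<le> e' * \<bar>w x\<bar>"
          by (intro mult_right_mono) (auto simp: dist_real_def)
        then show "\<bar>g (?p (Suc k)) * w x - g x * w x\<bar> \<le> e' * \<bar>w x\<bar>"
          by (simp only: abs_mult[symmetric] left_diff_distrib)
      next
        show "set_integrable M ?I (\<lambda>x. g (?p (Suc k)) * w x - g x * w x)"
          using int[OF k] by (intro set_integral_diff(1) set_integrable_mult_right)
        show "set_integrable M ?I (\<lambda>x. e' * \<bar>w x\<bar>)"
          using int[OF k] by (intro set_integrable_mult_right set_integrable_abs)
      qed
      finally show ?thesis by simp
    qed
    have "dist (\<Sum>k<n. g (?p (Suc k)) * (LINT x:{?p k<..?p (Suc k)}|M. w x)) (LINT x:{a<..b}|M. g x * w x)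
        = \<bar>\<Sum>k<n. g (?p (Suc k)) * (LINT x:{?p k<..?p (Suc k)}|M. w x)
            - (LINT x:{?p k<..?p (Suc k)}|M. g x * w x)\<bar>"
      using set_integral_Ioc_sum[OF M mono, of n "\<lambda>x. g x * w x"] gw
      by (simp add: p0 pn dist_real_def sum_subtractf)
    also have "\<dots> \<le> (\<Sum>k<n. e' * (LINT x:{?p k<..?p (Suc k)}|M. \<bar>w x\<bar>))"
      using cell by (intro order_trans[OF sum_abs] sum_mono) auto
    also have "\<dots> = e' * W"
      using set_integral_Ioc_sum[OF M mono, of n "\<lambda>x. \<bar>w x\<bar>"] set_integrable_abs[OF w]
      by (simp add: p0 pn W_def sum_distrib_left)
    also have "\<dots> < e"
      using \<open>e > 0\<close> \<open>W \<ge> 0\<close> by (simp add: e'_def field_simps)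
    finally show "dist (\<Sum>k<n. g (?p (Suc k)) * (LINT x:{?p k<..?p (Suc k)}|M. w x))
      (LINT x:{a<..b}|M. g x * w x) < e" .
  qed
qed

section \<open>From the measures of the Jordan parts to the density\<close>

lemma pos_variation_Ioc:
  assumes bv: "\<And>b. 0 \<le> b \<Longrightarrow> bounded_variation_on F 0 b"
    and cont: "\<And>t. 0 \<le> t \<Longrightarrow> continuous (at_right t) F"
    and "a \<le> b"
  shows "set_integrable (interval_measure (pos_variation F)) {a<..b} (\<lambda>_. 1 :: real)"
    and "(LINT x:{a<..b}|interval_measure (pos_variation F). 1)
      = pos_variation F b - pos_variation F a"
proof -
  note E = emeasure_pos_variation_Ioc[OF bv cont \<open>a \<le> b\<close>]
  show "set_integrable (interval_measure (pos_variation F)) {a<..b} (\<lambda>_. 1 :: real)"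
    unfolding set_integrable_def using E by simp
  have "measure (interval_measure (pos_variation F)) {a<..b} = pos_variation F b - pos_variation F a"
    using E pos_variation_mono[OF bv \<open>a \<le> b\<close>] by (simp add: measure_def)
  then show "(LINT x:{a<..b}|interval_measure (pos_variation F). 1)
      = pos_variation F b - pos_variation F a"
    by (simp add: set_lebesgue_integral_def)
qed

lemma tendsto_pos_variation_Riemann_sums:
  fixes g :: "real \<Rightarrow> real"
  assumes bv: "\<And>b. 0 \<le> b \<Longrightarrow> bounded_variation_on F 0 b"
    and cont: "\<And>t. 0 \<le> t \<Longrightarrow> continuous (at_right t) F"
    and "F 0 = 0" and "0 \<le> t" and g: "continuous_on {0..t} g"
  shows "(\<lambda>n. \<Sum>k<n. g (uniform_node 0 t n (Suc k)) * (pos_variation F (uniform_node 0 t n (Suc k)) - pos_variation F (uniform_node 0 t n k)))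
    \<longlonglongrightarrow> (LINT x:{0..t}|interval_measure (pos_variation F). g x)"
proof -
  let ?M = "interval_measure (pos_variation F)"
  \<comment> \<open>With \<open>F 0 = 0\<close> the part vanishes at 0 as it does at -1. So there is
    no atom at 0, and the closed interval of integration may be replaced by the half-open
    one.\<close>
  have "emeasure ?M {-1<..0} = 0"
    using emeasure_pos_variation_Ioc[OF bv cont, of "-1" 0] \<open>F 0 = 0\<close> by (simp add: pos_variation_def)
  then have "emeasure ?M {0} = 0"
    by (rule emeasure_eq_0[rotated]) auto
  then have eq: "(LINT x:{0..t}|?M. g x) = (LINT x:{0<..t}|?M. g x)"
    by (intro set_integral_discrete_difference[of "{0}"]) auto
  have "uniform_node 0 t n k \<le> uniform_node 0 t n (Suc k)" for n k
    by (rule monoD[OF mono_uniform_node[OF \<open>0 \<le> t\<close>]]) simp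
  then have mass: "(LINT x:{uniform_node 0 t n k<..uniform_node 0 t n (Suc k)}|?M. 1)
      = pos_variation F (uniform_node 0 t n (Suc k)) - pos_variation F (uniform_node 0 t n k)" for n k
    using bv cont by (intro pos_variation_Ioc(2))
  have "set_integrable ?M {0<..t} (\<lambda>_. 1 :: real)"
    using bv cont \<open>0 \<le> t\<close> by (intro pos_variation_Ioc(1))
  from tendsto_Riemann_sums[OF _ \<open>0 \<le> t\<close> g this] show ?thesis
    unfolding eq mass by simp
qed

lemma abs_continuous_increment:
  assumes ac: "abs_continuous_with_density T F f" and xy: "0 \<le> x" "x \<le> y" "y \<le> T"
  shows "F y - F x = (LINT z:{x<..y}|lborel. f z)"
proof -
  have f: "set_integrable lborel {0..T} f"
    and F: "\<And>x. x \<in> {0..T} \<Longrightarrow> F x = F 0 + (LINT y:{0..x}|lborel. f y)"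
    using ac unfolding abs_continuous_with_density_def by blast+
  have "{0..y} = {0..x} \<union> {x<..y}" "{0..x} \<inter> {x<..y} = {}" using xy by auto
  moreover have "{0..x} \<subseteq> {0..T}" "{x<..y} \<subseteq> {0..T}" using xy by auto
  then have "set_integrable lborel {0..x} f" "set_integrable lborel {x<..y} f"
    by (simp_all add: set_integrable_subset[OF f])
  ultimately have "(LINT z:{0..y}|lborel. f z) = (LINT z:{0..x}|lborel. f z) + (LINT z:{x<..y}|lborel. f z)"
    by (simp only: set_integral_Un)
  then show ?thesis using F[of x] F[of y] xy by simp
qed

lemma stieltjes_integral_density:
  assumes bv: "\<And>b. 0 \<le> b \<Longrightarrow> bounded_variation_on F 0 b"
    and cont: "\<And>t. 0 \<le> t \<Longrightarrow> continuous (at_right t) F"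
    and "F 0 = 0" and ac: "abs_continuous_with_density T F f"
    and t: "0 \<le> t" "t \<le> T" and g: "continuous_on {0..t} g"
  shows "stieltjes_integral F {0..t} g = (LINT x:{0<..t}|lborel. g x * f x)"
proof -
  let ?p = "uniform_node 0 t"
  define P where "P = pos_variation F"
  define N where "N = neg_variation F"
  have f: "set_integrable lborel {0..T} f"
    using ac unfolding abs_continuous_with_density_def by blast+
  have PN: "P x - N x = F x" if "0 \<le> x" for x
    using that by (simp add: P_def N_def pos_variation_def neg_variation_def field_simps)
  have limP: "(\<lambda>n. \<Sum>k<n. g (?p n (Suc k)) * (P (?p n (Suc k)) - P (?p n k)))
    \<longlonglongrightarrow> (LINT x:{0..t}|interval_measure P. g x)"
    unfolding P_def using bv cont \<open>F 0 = 0\<close> t(1) g by (rule tendsto_pos_variation_Riemann_sums[of F t g])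
  have limN: "(\<lambda>n. \<Sum>k<n. g (?p n (Suc k)) * (N (?p n (Suc k)) - N (?p n k)))
    \<longlonglongrightarrow> (LINT x:{0..t}|interval_measure N. g x)"
    unfolding N_def neg_variation_eq
  proof (rule tendsto_pos_variation_Riemann_sums[of "\<lambda>x. - F x" t g])
    show "bounded_variation_on (\<lambda>x. - F x) 0 b" if "0 \<le> b" for b
      using bv[OF that] by (simp add: bounded_variation_on_uminus)
    show "continuous (at_right t) (\<lambda>x. - F x)" if "0 \<le> t" for t
      using cont[OF that] by (rule continuous_minus)
  qed (use \<open>F 0 = 0\<close> t g in simp_all)
  have "(\<lambda>n. \<Sum>k<n. g (?p n (Suc k)) * (LINT x:{?p n k<..?p n (Suc k)}|lborel. f x))
    \<longlonglongrightarrow> (LINT x:{0<..t}|lborel. g x * f x)"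
  proof (rule tendsto_Riemann_sums[of lborel 0 t g f])
    have "{0<..t} \<subseteq> {0..T}" using t by auto
    then show "set_integrable lborel {0<..t} f"
      by (simp add: set_integrable_subset[OF f])
  qed (use t g in simp_all)
  \<comment> \<open>Here the parts meet the density: on each cell the increment of
    \<open>P - N\<close> is that of \<open>F\<close>, hence the integral of \<open>f\<close>. The
    identity is exact for every \<open>n\<close>, so the limits agree.\<close>
  moreover have "(\<Sum>k<n. g (?p n (Suc k)) * (P (?p n (Suc k)) - P (?p n k)))
      - (\<Sum>k<n. g (?p n (Suc k)) * (N (?p n (Suc k)) - N (?p n k)))
      = (\<Sum>k<n. g (?p n (Suc k)) * (LINT x:{?p n k<..?p n (Suc k)}|lborel. f x))" for n
    unfolding sum_subtractf[symmetric]
  proof (intro sum.cong refl)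
    fix k assume "k \<in> {..<n}"
    then have k: "Suc k \<le> n" by simp
    have p: "0 \<le> ?p n k" "?p n k \<le> ?p n (Suc k)" "?p n (Suc k) \<le> T"
      using uniform_node_in[of 0 t n k] uniform_node_in[of 0 t n "Suc k"]
        monoD[OF mono_uniform_node[of 0 t n], of k "Suc k"] k t by auto
    have lint: "(LINT x:{?p n k<..?p n (Suc k)}|lborel. f x)
        = (P (?p n (Suc k)) - N (?p n (Suc k))) - (P (?p n k) - N (?p n k))"
      using abs_continuous_increment[OF ac p] PN[OF p(1)] PN[OF order_trans[OF p(1,2)]]
      by (simp only:)
    show "g (?p n (Suc k)) * (P (?p n (Suc k)) - P (?p n k))
        - g (?p n (Suc k)) * (N (?p n (Suc k)) - N (?p n k))
        = g (?p n (Suc k)) * (LINT x:{?p n k<..?p n (Suc k)}|lborel. f x)"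
      unfolding lint by (simp add: algebra_simps)
  qed
  ultimately have "(\<lambda>n. (\<Sum>k<n. g (?p n (Suc k)) * (P (?p n (Suc k)) - P (?p n k)))
      - (\<Sum>k<n. g (?p n (Suc k)) * (N (?p n (Suc k)) - N (?p n k))))
    \<longlonglongrightarrow> (LINT x:{0<..t}|lborel. g x * f x)"
    by (simp only:)
  from tendsto_diff[OF limP limN] this
  have "(LINT x:{0..t}|interval_measure P. g x) - (LINT x:{0..t}|interval_measure N. g x)
      = (LINT x:{0<..t}|lborel. g x * f x)"
    by (rule LIMSEQ_unique)
  then show ?thesis
    by (simp only: stieltjes_integral_def P_def N_def)
qed

section \<open>Quadrature error on one cell\<close>

text \<open>Two mean value inequalities, one for \<open>f'\<close> and one for the remainder,
  replace an explicit remainder term: \<open>f''\<close> enters through its bound alone, and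
  one-sided derivatives at the ends are admissible.\<close>

lemma quadratic_Taylor_bound:
  fixes f :: "real \<Rightarrow> real"
  assumes f: "\<And>x. x \<in> {a..b} \<Longrightarrow> (f has_real_derivative f' x) (at x within {a..b})"
    and f': "\<And>x. x \<in> {a..b} \<Longrightarrow> (f' has_real_derivative f'' x) (at x within {a..b})"
    and M: "\<And>x. x \<in> {a..b} \<Longrightarrow> \<bar>f'' x\<bar> \<le> M"
    and c: "c \<in> {a..b}" and y: "y \<in> {a..b}"
  shows "\<bar>f y - f c - f' c * (y - c)\<bar> \<le> M * (y - c)\<^sup>2 / 2"
proof -
  \<comment> \<open>Running along the segment from \<open>c\<close> to \<open>y\<close> treats both
    orders of the two points at once. The derivative of \<open>\<phi>\<close> at \<open>s\<close> is
    at most \<open>M * (y - c)\<^sup>2 * s\<close>, which integrates to the quadratic majorant used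
    below.\<close>
  define l where "l s = c + s * (y - c)" for s
  define \<phi> where "\<phi> s = f (l s) - s * (f' c * (y - c))" for s
  have l: "l s \<in> {a..b}" if "s \<in> {0..1}" for s
  proof -
    have "(1 - s) *\<^sub>R c + s *\<^sub>R y \<in> {a..b}"
      using that c y by (intro convexD[OF convex_real_interval(5)]) auto
    then show ?thesis by (simp add: l_def algebra_simps)
  qed
  have deriv: "(\<phi> has_vector_derivative (f' (l s) * (y - c) - f' c * (y - c))) (at s within {0..1})"
    if s: "s \<in> {0..1}" for s
  proof -
    have "(l has_real_derivative (y - c)) (at s within {0..1})"
      unfolding l_def by (auto intro!: derivative_eq_intros)
    moreover have "(f has_real_derivative f' (l s)) (at (l s) within l ` {0..1})"
      using l by (intro DERIV_subset[OF f[OF l[OF s]]]) auto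
    ultimately have "((f \<circ> l) has_real_derivative (f' (l s) * (y - c))) (at s within {0..1})"
      by (intro DERIV_image_chain)
    then have "(\<phi> has_real_derivative (f' (l s) * (y - c) - f' c * (y - c))) (at s within {0..1})"
      unfolding \<phi>_def comp_def by (auto intro!: derivative_eq_intros)
    then show ?thesis by (simp add: has_real_derivative_iff_has_vector_derivative)
  qed
  have "norm (\<phi> 1 - \<phi> 0) \<le> M * (y - c)\<^sup>2 * 1\<^sup>2 / 2 - M * (y - c)\<^sup>2 * 0\<^sup>2 / 2"
  proof (rule differentiable_bound_general[where \<phi> = "\<lambda>s. M * (y - c)\<^sup>2 * s\<^sup>2 / 2"])
    show "continuous_on {0..1} \<phi>"
      using deriv by (intro continuous_on_vector_derivative)
    show "continuous_on {0..1} (\<lambda>s. M * (y - c)\<^sup>2 * s\<^sup>2 / 2)"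
      by (intro continuous_intros) simp
    fix s :: real assume s: "0 < s" "s < 1"
    show "(\<phi> has_vector_derivative (f' (l s) * (y - c) - f' c * (y - c))) (at s)"
      using deriv[of s] s by (simp add: at_within_Icc_at)
    show "((\<lambda>s. M * (y - c)\<^sup>2 * s\<^sup>2 / 2) has_vector_derivative M * (y - c)\<^sup>2 * s) (at s)"
      unfolding has_real_derivative_iff_has_vector_derivative[symmetric]
      by (auto intro!: derivative_eq_intros)
    have "norm (f' (l s) - f' c) \<le> M * norm (l s - c)"
      using l[of s] s c f' M by (intro field_differentiable_bound[of "{a..b}"]) auto
    then have "\<bar>f' (l s) - f' c\<bar> * \<bar>y - c\<bar> \<le> M * \<bar>s * (y - c)\<bar> * \<bar>y - c\<bar>"
      by (intro mult_right_mono) (simp_all add: l_def)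
    also have "\<dots> = M * (y - c)\<^sup>2 * s"
      using s by (simp add: abs_mult power2_eq_square)
    finally show "norm (f' (l s) * (y - c) - f' c * (y - c)) \<le> M * (y - c)\<^sup>2 * s"
      by (simp only: real_norm_def abs_mult[symmetric] left_diff_distrib)
  qed simp
  moreover have "\<phi> 1 - \<phi> 0 = f y - f c - f' c * (y - c)"
    by (simp add: \<phi>_def l_def)
  ultimately show ?thesis by simp
qed

text \<open>With \<open>c\<close> the midpoint of the cell, \<open>b (\<tau> - x)\<close> minus its endpoint average is
  \<open>- b' (\<tau> - c) * (x - c)\<close> up to \<open>B2 * h\<^sup>2 / 4\<close>.  In the linear term \<open>a\<close> may be replaced by
  \<open>a x - a c\<close>, because \<open>x - c\<close> has integral zero; this yields the factor \<open>1 / 12\<close>.\<close>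

lemma cell_error:
  fixes a b :: "real \<Rightarrow> real"
  assumes b: "\<And>x. x \<in> {0..T} \<Longrightarrow> (b has_real_derivative b' x) (at x within {0..T})"
    and b': "\<And>x. x \<in> {0..T} \<Longrightarrow> (b' has_real_derivative b'' x) (at x within {0..T})"
    and a: "\<And>x. x \<in> {0..T} \<Longrightarrow> (a has_real_derivative a' x) (at x within {0..T})"
    and A0: "\<And>x. x \<in> {0..T} \<Longrightarrow> \<bar>a x\<bar> \<le> A0" and A1: "\<And>x. x \<in> {0..T} \<Longrightarrow> \<bar>a' x\<bar> \<le> A1"
    and B1: "\<And>x. x \<in> {0..T} \<Longrightarrow> \<bar>b' x\<bar> \<le> B1" and B2: "\<And>x. x \<in> {0..T} \<Longrightarrow> \<bar>b'' x\<bar> \<le> B2"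
    and h: "h > 0" and q: "q = p + h" and p: "0 \<le> p" and qt: "q \<le> \<tau>" and \<tau>: "\<tau> \<le> T"
  shows "\<bar>(LINT x:{p<..q}|lborel. b (\<tau> - x) * a x)
      - (b (\<tau> - p) + b (\<tau> - q)) / 2 * (LINT x:{p<..q}|lborel. a x)\<bar>
    \<le> h ^ 3 * (A1 * B1 / 12 + A0 * B2 / 4)"
proof -
  define c where "c = (p + q) / 2"
  define avg where "avg = (b (\<tau> - p) + b (\<tau> - q)) / 2"
  define \<beta> where "\<beta> = b' (\<tau> - c)"
  define u where "u x = b (\<tau> - x) * a x - avg * a x" for x
  have c: "p \<le> c" "c \<le> q" "q - c = h / 2" "c - p = h / 2" using q h by (auto simp: c_def field_simps)
  have inT: "x \<in> {0..T}" "\<tau> - x \<in> {0..T}" if "x \<in> {p..q}" for x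
    using that p qt \<tau> by auto
  have cpq: "c \<in> {p..q}" using c by simp
  have nonneg: "0 \<le> A0" "0 \<le> B2" "0 \<le> B1" "0 \<le> A1"
    using A0[OF inT(1)[OF cpq]] B2[OF inT(1)[OF cpq]] B1[OF inT(1)[OF cpq]] A1[OF inT(1)[OF cpq]]
    by (auto intro: order_trans[OF abs_ge_zero])
  \<comment> \<open>Every point of the cell lies within \<open>h / 2\<close> of the midpoint, and
    half the square of that is \<open>h\<^sup>2 / 8\<close>. The reflection of the argument turns
    the sign of the linear term.\<close>
  have taylor: "\<bar>b (\<tau> - x) - b (\<tau> - c) + \<beta> * (x - c)\<bar> \<le> B2 * h\<^sup>2 / 8" if x: "x \<in> {p..q}" for x
  proof -
    have "\<bar>b (\<tau> - x) - b (\<tau> - c) - \<beta> * ((\<tau> - x) - (\<tau> - c))\<bar> \<le> B2 * ((\<tau> - x) - (\<tau> - c))\<^sup>2 / 2"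
      unfolding \<beta>_def by (rule quadratic_Taylor_bound[OF b b' B2 inT(2)[OF cpq] inT(2)[OF x]])
    also have "\<dots> \<le> B2 * (h / 2)\<^sup>2 / 2"
    proof -
      have "\<bar>(\<tau> - x) - (\<tau> - c)\<bar> \<le> \<bar>h / 2\<bar>"
        using x c h unfolding atLeastAtMost_iff by linarith
      then show ?thesis
        unfolding abs_le_square_iff using nonneg by (intro divide_right_mono mult_left_mono) auto
    qed
    finally show ?thesis by (simp add: algebra_simps power2_eq_square)
  qed
  \<comment> \<open>In the endpoint average the linear terms cancel because \<open>c\<close> is the
    midpoint. The remainder at \<open>x\<close> and the mean of the two endpoint remainders add up
    to 1/8 + 1/8 = 1/4.\<close>
  have linear: "\<bar>b (\<tau> - x) - avg + \<beta> * (x - c)\<bar> \<le> B2 * h\<^sup>2 / 4" if x: "x \<in> {p..q}" for x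
  proof -
    have ends: "p \<in> {p..q}" "q \<in> {p..q}" using q h by auto
    have "\<beta> * (p - c) = - (\<beta> * (q - c))" by (simp add: c_def algebra_simps)
    have arith: "\<bar>r - (s + s') / 2 + w\<bar> \<le> 2 * e"
      if "\<bar>r - z + w\<bar> \<le> e" "\<bar>s - z + v\<bar> \<le> e" "\<bar>s' - z + v'\<bar> \<le> e" "v = - v'"
      for r s s' z w v v' e :: real
      using that by argo
    show ?thesis
      using arith[OF taylor[OF x] taylor[OF ends(1)] taylor[OF ends(2)] \<open>\<beta> * (p - c) = - (\<beta> * (q - c))\<close>]
      unfolding avg_def by simp
  qed
  have bound: "\<bar>u x + \<beta> * a c * (x - c)\<bar> \<le> A0 * B2 * h\<^sup>2 / 4 + A1 * B1 * (x - c)\<^sup>2" if x: "x \<in> {p..q}" for x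
  proof -
    have "u x + \<beta> * a c * (x - c) = (b (\<tau> - x) - avg + \<beta> * (x - c)) * a x - \<beta> * ((a x - a c) * (x - c))"
      by (simp add: u_def algebra_simps)
    also have "\<bar>\<dots>\<bar> \<le> \<bar>b (\<tau> - x) - avg + \<beta> * (x - c)\<bar> * \<bar>a x\<bar> + \<bar>\<beta>\<bar> * (\<bar>a x - a c\<bar> * \<bar>x - c\<bar>)"
      by (rule order_trans[OF abs_triangle_ineq4]) (simp add: abs_mult)
    also have "\<dots> \<le> B2 * h\<^sup>2 / 4 * A0 + B1 * ((A1 * \<bar>x - c\<bar>) * \<bar>x - c\<bar>)"
    proof (intro add_mono mult_mono)
      have "norm (a x - a c) \<le> A1 * norm (x - c)"
        using a A1 inT[OF x] inT[OF cpq] by (intro field_differentiable_bound[of "{0..T}"]) auto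
      then show "\<bar>a x - a c\<bar> \<le> A1 * \<bar>x - c\<bar>" by simp
    qed (use linear[OF x] A0 B1 inT[OF x] inT[OF cpq] nonneg in \<open>auto simp: \<beta>_def\<close>)
    finally show ?thesis by (simp add: power2_eq_square mult_ac)
  qed
  have cont_a: "continuous_on {p..q} a"
    by (rule continuous_on_subset[OF DERIV_continuous_on[OF a]]) (use inT(1) in auto)
  have "continuous_on {p..q} (\<lambda>x. b (\<tau> - x))"
    using inT(2) by (intro continuous_on_compose2[OF DERIV_continuous_on[OF b]] continuous_intros) auto
  note cont = this cont_a
  have cont_u: "continuous_on {p..q} u"
    unfolding u_def by (intro continuous_intros cont)
  have Ioc: "set_integrable lborel {p<..q} f" if "continuous_on {p..q} f" for f :: "real \<Rightarrow> real"
    by (rule set_integrable_subset[OF borel_integrable_atLeastAtMost'[OF that]]) auto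
  have "(LINT x:{p<..q}|lborel. b (\<tau> - x) * a x) - avg * (LINT x:{p<..q}|lborel. a x)
      = (LINT x:{p<..q}|lborel. u x)"
    unfolding u_def
    using set_integral_diff(2)[OF Ioc[OF continuous_on_mult[OF cont]]
        set_integrable_mult_right[OF Ioc[OF cont_a]], of avg] by simp
  \<comment> \<open>A point is Lebesgue null; on the closed interval the fundamental theorem of
    calculus becomes available.\<close>
  also have "\<dots> = (LINT x:{p..q}|lborel. u x)"
    by (rule set_integral_discrete_difference[of "{p}"]) auto
  also have "\<dots> = integral {p..q} u"
    by (rule set_borel_integral_eq_integral(2)[OF borel_integrable_atLeastAtMost'[OF cont_u]])
  also have "\<dots> = integral {p..q} (\<lambda>x. u x + \<beta> * a c * (x - c))"
  proof -
    have "((\<lambda>x. \<beta> * a c * (x - c)) has_integral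
        \<beta> * a c * (q - c)\<^sup>2 / 2 - \<beta> * a c * (p - c)\<^sup>2 / 2) {p..q}"
      using c by (intro fundamental_theorem_of_calculus)
        (auto simp flip: has_real_derivative_iff_has_vector_derivative intro!: derivative_eq_intros)
    moreover have "(p - c)\<^sup>2 = (q - c)\<^sup>2"
      using c by (simp add: power2_commute[of p c])
    ultimately have "((\<lambda>x. \<beta> * a c * (x - c)) has_integral 0) {p..q}" by simp
    from has_integral_add[OF integrable_integral[OF integrable_continuous_interval[OF cont_u]] this]
    show ?thesis by (simp add: integral_unique)
  qed
  also have "\<bar>\<dots>\<bar> \<le> integral {p..q} (\<lambda>x. A0 * B2 * h\<^sup>2 / 4 + A1 * B1 * (x - c)\<^sup>2)"
    using Henstock_Kurzweil_Integration.integral_norm_bound_integral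
      [of "\<lambda>x. u x + \<beta> * a c * (x - c)" "{p..q}" "\<lambda>x. A0 * B2 * h\<^sup>2 / 4 + A1 * B1 * (x - c)\<^sup>2",
        OF integrable_continuous_interval integrable_continuous_interval] bound
    by (simp add: cont_u continuous_intros)
  also have "\<dots> = (A0 * B2 * h\<^sup>2 / 4 * q + A1 * B1 * (q - c) ^ 3 / 3)
      - (A0 * B2 * h\<^sup>2 / 4 * p + A1 * B1 * (p - c) ^ 3 / 3)"
    using c by (intro integral_unique fundamental_theorem_of_calculus)
      (auto simp flip: has_real_derivative_iff_has_vector_derivative intro!: derivative_eq_intros)
  \<comment> \<open>At the ends \<open>x - c\<close> equals \<open>h / 2\<close> up to sign, so the
    cubic term contributes 2 (h/2)^3 / 3 = h^3 / 12; the constant term is multiplied by the length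
    \<open>h\<close>.\<close>
  also have "\<dots> = h ^ 3 * (A1 * B1 / 12 + A0 * B2 / 4)"
    unfolding c_def q by (simp add: field_simps power2_eq_square power3_eq_cube)
  finally show ?thesis unfolding avg_def .
qed

section \<open>Error of the discretized convolution\<close>

lemma Ck_on_has_real_derivative:
  assumes "Ck_on k S f" "l < k" "x \<in> S"
  shows "(nth_deriv_within S l f has_real_derivative nth_deriv_within S (Suc l) f x) (at x within S)"
proof -
  have "nth_deriv_within S l f differentiable (at x within S)"
    using assms by (auto simp: Ck_on_def differentiable_on_def)
  then show ?thesis
    by (simp add: vector_derivative_works has_real_derivative_iff_has_vector_derivative)
qed

lemma Ck_on_continuous:
  assumes "Ck_on k S f" "l \<le> k"
  shows "continuous_on S (nth_deriv_within S l f)"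
proof (cases "l = k")
  case False
  with assms show ?thesis
    by (auto simp: Ck_on_def intro: differentiable_imp_continuous_on)
qed (use assms in \<open>simp add: Ck_on_def\<close>)

text \<open>A real \<open>SUP\<close> dominates its members only if they are bounded, which
  continuity on a compact interval ensures; \<open>Max\<close> likewise relies on the finite index
  type.\<close>

lemma abs_le_max_deriv_norm:
  assumes "continuous_on {0..T} (nth_deriv_within {0..T} k (\<lambda>t. F t $ i $ j))" and "x \<in> {0..T}"
  shows "\<bar>nth_deriv_within {0..T} k (\<lambda>t. F t $ i $ j) x\<bar> \<le> max_deriv_norm T k F"
proof -
  let ?g = "\<lambda>i j. nth_deriv_within {0..T} k (\<lambda>t. F t $ i $ j)"
  have "compact ((\<lambda>x. \<bar>?g i j x\<bar>) ` {0..T})"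
    using assms(1) by (intro compact_continuous_image continuous_intros) auto
  then have "\<bar>?g i j x\<bar> \<le> sup_norm_on {0..T} (?g i j)"
    unfolding sup_norm_on_def using assms(2)
    by (intro cSUP_upper bounded_imp_bdd_above compact_imp_bounded)
  also have "\<dots> \<le> max_deriv_norm T k F"
  proof -
    have "{sup_norm_on {0..T} (?g i j) |i j. True} = range (\<lambda>(i, j). sup_norm_on {0..T} (?g i j))"
      by auto
    then show ?thesis
      unfolding max_deriv_norm_def by (intro Max_ge) auto
  qed
  finally show ?thesis .
qed

lemma frobenius_norm_le:
  fixes X :: "real^('n::finite)^'n"
  assumes "\<And>i j. \<bar>X $ i $ j\<bar> \<le> c"
  shows "frobenius_norm X \<le> real CARD('n) * c"
proof -
  have "0 \<le> c" using order_trans[OF abs_ge_zero assms] .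
  have "(\<Sum>i\<in>UNIV. \<Sum>j\<in>UNIV. (X $ i $ j)\<^sup>2) \<le> (\<Sum>i\<in>(UNIV :: 'n set). \<Sum>j\<in>(UNIV :: 'n set). c\<^sup>2)"
  proof (intro sum_mono)
    fix i j
    show "(X $ i $ j)\<^sup>2 \<le> c\<^sup>2"
      using assms[of i j] \<open>0 \<le> c\<close> by (intro abs_le_square_iff[THEN iffD1]) simp
  qed
  also have "\<dots> = (real CARD('n) * c)\<^sup>2"
    by (simp add: power2_eq_square)
  finally show ?thesis
    unfolding frobenius_norm_def using \<open>0 \<le> c\<close> by (intro real_le_lsqrt sum_nonneg zero_le_power2 mult_nonneg_nonneg) simp_all
qed

text \<open>One scalar summand of one matrix entry. Cell \<open>k\<close> is an instance of the
  one-cell estimate with \<open>p = grid h k\<close>, \<open>q = grid h (Suc k)\<close> and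
  \<open>\<tau> = grid h m\<close>.\<close>

lemma convolution_entry_error:
  fixes F f b :: "real \<Rightarrow> real"
  assumes bv: "\<And>b. 0 \<le> b \<Longrightarrow> bounded_variation_on F 0 b"
    and cont: "\<And>t. 0 \<le> t \<Longrightarrow> continuous (at_right t) F"
    and F0: "F 0 = 0" and ac: "abs_continuous_with_density T F f"
    and f: "Ck_on 1 {0..T} f" and b: "Ck_on 2 {0..T} b"
    and A0: "\<And>x. x \<in> {0..T} \<Longrightarrow> \<bar>f x\<bar> \<le> A0"
    and A1: "\<And>x. x \<in> {0..T} \<Longrightarrow> \<bar>nth_deriv_within {0..T} 1 f x\<bar> \<le> A1"
    and B1: "\<And>x. x \<in> {0..T} \<Longrightarrow> \<bar>nth_deriv_within {0..T} 1 b x\<bar> \<le> B1"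
    and B2: "\<And>x. x \<in> {0..T} \<Longrightarrow> \<bar>nth_deriv_within {0..T} 2 b x\<bar> \<le> B2"
    and h: "h > 0" and m: "grid h m \<le> T"
  shows "\<bar>stieltjes_integral F {0..grid h m} (\<lambda>x. b (grid h m - x))
      - (\<Sum>k<m. (F (grid h (Suc k)) - F (grid h k))
          * ((b (grid h m - grid h k) + b (grid h m - grid h (Suc k))) / 2))\<bar>
    \<le> T * h\<^sup>2 * (A1 * B1 / 12 + A0 * B2 / 4)"
proof -
  let ?t = "grid h" and ?K = "A1 * B1 / 12 + A0 * B2 / 4"
  let ?I = "\<lambda>k. {?t k<..?t (Suc k)}"
  have t0: "?t 0 = 0" and tm: "0 \<le> ?t m" and step: "?t (Suc k) = ?t k + h" for k
    using h by (simp_all add: grid_def distrib_right)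
  have mono: "mono ?t" using h by (intro monoI) (simp add: grid_def)
  have df: "(f has_real_derivative nth_deriv_within {0..T} 1 f x) (at x within {0..T})"
    if "x \<in> {0..T}" for x
    using Ck_on_has_real_derivative[OF f zero_less_one that]
    unfolding nth_deriv_within.simps(1) One_nat_def .
  have db: "(b has_real_derivative nth_deriv_within {0..T} 1 b x) (at x within {0..T})"
    if "x \<in> {0..T}" for x
    using Ck_on_has_real_derivative[OF b zero_less_numeral that]
    unfolding nth_deriv_within.simps(1) One_nat_def .
  have less_two: "1 < (2 :: nat)" by simp
  have ddb: "(nth_deriv_within {0..T} 1 b has_real_derivative nth_deriv_within {0..T} 2 b x)
      (at x within {0..T})" if "x \<in> {0..T}" for x
    using Ck_on_has_real_derivative[OF b less_two that] unfolding Suc_1 .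
  have zero: "0 \<in> {0..T}" using tm m by simp
  have "0 \<le> A0" "0 \<le> A1" "0 \<le> B1" "0 \<le> B2"
    using A0[OF zero] A1[OF zero] B1[OF zero] B2[OF zero] by linarith+
  then have K: "0 \<le> ?K"
    by (intro add_nonneg_nonneg divide_nonneg_nonneg mult_nonneg_nonneg) simp_all
  have cont_b: "continuous_on {0..?t m} (\<lambda>x. b (?t m - x))"
    using m by (intro continuous_on_compose2[OF DERIV_continuous_on[OF db]] continuous_intros) auto
  have f_int: "set_integrable lborel {0..T} f"
    using ac unfolding abs_continuous_with_density_def by blast
  have "{0<..?t m} \<subseteq> {0..T}" using m by auto
  then have "set_integrable lborel {0<..?t m} f"
    by (simp add: set_integrable_subset[OF f_int])
  then have int: "set_integrable lborel {?t 0<..?t m} (\<lambda>x. b (?t m - x) * f x)"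
    unfolding t0 using cont_b by (intro set_integrable_continuous_mult) simp_all
  have "stieltjes_integral F {0..?t m} (\<lambda>x. b (?t m - x))
      = (LINT x:{?t 0<..?t m}|lborel. b (?t m - x) * f x)"
    unfolding t0 using bv cont F0 ac tm m cont_b by (rule stieltjes_integral_density)
  also have "\<dots> = (\<Sum>k<m. LINT x:?I k|lborel. b (?t m - x) * f x)"
    by (rule set_integral_Ioc_sum[OF _ mono int]) simp
  finally have conv: "stieltjes_integral F {0..?t m} (\<lambda>x. b (?t m - x))
      = (\<Sum>k<m. LINT x:?I k|lborel. b (?t m - x) * f x)" .
  have incr: "(F (?t (Suc k)) - F (?t k)) * v = v * (LINT x:?I k|lborel. f x)" if "k < m" for k v
  proof -
    have "?t (Suc k) \<le> ?t m" using mono that by (intro monoD[of ?t]) auto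
    with m have "?t (Suc k) \<le> T" by simp
    moreover have "0 \<le> ?t k" "?t k \<le> ?t (Suc k)" using h by (simp_all add: grid_def)
    ultimately have "F (?t (Suc k)) - F (?t k) = (LINT x:?I k|lborel. f x)"
      by (intro abs_continuous_increment[OF ac])
    then show ?thesis by (simp only: mult.commute)
  qed
  have "(\<Sum>k<m. (F (?t (Suc k)) - F (?t k)) * ((b (?t m - ?t k) + b (?t m - ?t (Suc k))) / 2))
      = (\<Sum>k<m. (b (?t m - ?t k) + b (?t m - ?t (Suc k))) / 2 * (LINT x:?I k|lborel. f x))"
    by (rule sum.cong[OF refl]) (rule incr, simp only: lessThan_iff)
  then have eq: "stieltjes_integral F {0..?t m} (\<lambda>x. b (?t m - x))
      - (\<Sum>k<m. (F (?t (Suc k)) - F (?t k)) * ((b (?t m - ?t k) + b (?t m - ?t (Suc k))) / 2))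
      = (\<Sum>k<m. (LINT x:?I k|lborel. b (?t m - x) * f x)
        - (b (?t m - ?t k) + b (?t m - ?t (Suc k))) / 2 * (LINT x:?I k|lborel. f x))"
    by (simp only: conv sum_subtractf)
  have "\<bar>\<Sum>k<m. (LINT x:?I k|lborel. b (?t m - x) * f x)
        - (b (?t m - ?t k) + b (?t m - ?t (Suc k))) / 2 * (LINT x:?I k|lborel. f x)\<bar>
      \<le> (\<Sum>k<m. h ^ 3 * ?K)"
  proof (rule order_trans[OF sum_abs], rule sum_mono)
    fix k assume "k \<in> {..<m}"
    then have le: "?t (Suc k) \<le> ?t m" by (intro monoD[OF mono]) simp
    have ge: "0 \<le> ?t k" using h by (simp add: grid_def)
    show "\<bar>(LINT x:?I k|lborel. b (?t m - x) * f x)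
        - (b (?t m - ?t k) + b (?t m - ?t (Suc k))) / 2 * (LINT x:?I k|lborel. f x)\<bar> \<le> h ^ 3 * ?K"
      by (rule cell_error[OF db ddb df A0 A1 B1 B2 h step ge le m])
  qed
  \<comment> \<open>One of the three powers of \<open>h\<close> is absorbed by the number of cells,
    as \<open>m * h\<close> is the final grid point. Replacing that point by \<open>T\<close>
    afterwards relies on \<open>0 \<le> ?K\<close>.\<close>
  also have "\<dots> = ?t m * (h\<^sup>2 * ?K)"
    by (simp only: grid_def sum_constant card_lessThan power3_eq_cube power2_eq_square mult_ac)
  also have "\<dots> \<le> T * (h\<^sup>2 * ?K)"
    by (rule mult_right_mono[OF m mult_nonneg_nonneg[OF zero_le_power2 K]])
  finally show ?thesis unfolding eq by (simp only: mult.assoc)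
qed

text \<open>The term \<open>l = 0\<close> vanishes by the convention for the increment at 0, and the
  shift \<open>l = Suc k\<close> indexes the rest by cells. The average of \<open>B\<close> then
  consists of the two end values of the reflected kernel on cell \<open>k\<close>, as in the
  trapezoidal rule.\<close>

lemma discrete_conv_entry:
  "discrete_conv (grid_increment h A) (grid_average h B) m $ i $ j
    = (\<Sum>r\<in>UNIV. \<Sum>k<m. (A (grid h (Suc k)) $ i $ r - A (grid h k) $ i $ r)
        * ((B (grid h m - grid h k) $ r $ j + B (grid h m - grid h (Suc k)) $ r $ j) / 2))"
proof -
  have "discrete_conv (grid_increment h A) (grid_average h B) m $ i $ j
      = (\<Sum>l\<le>m. \<Sum>r\<in>UNIV. grid_increment h A l $ i $ r * grid_average h B (m - l) $ r $ j)"
    by (simp add: discrete_conv_def matrix_matrix_mult_def atLeast0AtMost)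
  also have "\<dots> = (\<Sum>k<m. \<Sum>r\<in>UNIV. grid_increment h A (Suc k) $ i $ r * grid_average h B (m - Suc k) $ r $ j)"
    by (simp add: lessThan_Suc_atMost[symmetric] sum.lessThan_Suc_shift grid_increment_def del: sum.lessThan_Suc)
  also have "\<dots> = (\<Sum>k<m. \<Sum>r\<in>UNIV. (A (grid h (Suc k)) $ i $ r - A (grid h k) $ i $ r)
        * ((B (grid h m - grid h k) $ r $ j + B (grid h m - grid h (Suc k)) $ r $ j) / 2))"
  proof (intro sum.cong refl)
    fix k r assume "k \<in> {..<m}"
    \<comment> \<open>Because \<open>k < m\<close>, the truncated subtraction on the naturals is
      exact here.\<close>
    then have "grid h (m - Suc k + 1) = grid h m - grid h k" "grid h (m - Suc k) = grid h m - grid h (Suc k)"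
      by (auto simp: grid_def of_nat_diff algebra_simps)
    then show "grid_increment h A (Suc k) $ i $ r * grid_average h B (m - Suc k) $ r $ j
        = (A (grid h (Suc k)) $ i $ r - A (grid h k) $ i $ r)
        * ((B (grid h m - grid h k) $ r $ j + B (grid h m - grid h (Suc k)) $ r $ j) / 2)"
      by (simp add: grid_increment_def grid_average_def)
  qed
  also have "\<dots> = (\<Sum>r\<in>UNIV. \<Sum>k<m. (A (grid h (Suc k)) $ i $ r - A (grid h k) $ i $ r)
        * ((B (grid h m - grid h k) $ r $ j + B (grid h m - grid h (Suc k)) $ r $ j) / 2))"
    by (rule sum.swap)
  finally show ?thesis .
qed

theorem corollary3p2:
  fixes A B a :: "real \<Rightarrow> real^('n::finite)^'n"
    and T h :: real and m :: nat
  assumes "T > 0" and "h > 0"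
    and "\<And>i j t. t \<ge> 0 \<Longrightarrow> continuous (at_right t) (\<lambda>x. A x $ i $ j)"
    and "\<And>i j b. b \<ge> 0 \<Longrightarrow> bounded_variation_on (\<lambda>x. A x $ i $ j) 0 b"
    and "A 0 = 0"
    and "\<And>i j. (\<lambda>x. B x $ i $ j) \<in> borel_measurable (restrict_space borel {0..})"
    and "\<And>i j b. b \<ge> 0 \<Longrightarrow> bounded ((\<lambda>x. B x $ i $ j) ` {0..b})"
    and "\<And>i r. abs_continuous_with_density T (\<lambda>x. A x $ i $ r) (\<lambda>x. a x $ i $ r)"
    and "\<And>i r. Ck_on 1 {0..T} (\<lambda>x. a x $ i $ r)"
    and "\<And>r j. Ck_on 2 {0..T} (\<lambda>x. B x $ r $ j)"
    and "grid h m \<le> T"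
  shows "frobenius_norm (discretization_error h A B m)
    \<le> real CARD('n) ^ 2 * T * h ^ 2 *
      (max_deriv_norm T 1 a * max_deriv_norm T 1 B / 12
       + max_deriv_norm T 0 a * max_deriv_norm T 2 B / 4)"
proof -
  let ?K = "max_deriv_norm T 1 a * max_deriv_norm T 1 B / 12
       + max_deriv_norm T 0 a * max_deriv_norm T 2 B / 4"
  let ?E = "\<lambda>i r j. stieltjes_integral (\<lambda>x. A x $ i $ r) {0..grid h m} (\<lambda>x. B (grid h m - x) $ r $ j)
      - (\<Sum>k<m. (A (grid h (Suc k)) $ i $ r - A (grid h k) $ i $ r)
        * ((B (grid h m - grid h k) $ r $ j + B (grid h m - grid h (Suc k)) $ r $ j) / 2))"
  have summand: "\<bar>?E i r j\<bar> \<le> T * h\<^sup>2 * ?K" for i r j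
  proof (rule convolution_entry_error[OF assms(4,3) _ assms(8,9,10)])
    fix x assume x: "x \<in> {0..T}"
    show "\<bar>a x $ i $ r\<bar> \<le> max_deriv_norm T 0 a"
      using abs_le_max_deriv_norm[OF Ck_on_continuous[OF assms(9)] x, of 0] by simp
    show "\<bar>nth_deriv_within {0..T} 1 (\<lambda>x. a x $ i $ r) x\<bar> \<le> max_deriv_norm T 1 a"
      by (rule abs_le_max_deriv_norm[OF Ck_on_continuous[OF assms(9)] x]) simp
    show "\<bar>nth_deriv_within {0..T} 1 (\<lambda>x. B x $ r $ j) x\<bar> \<le> max_deriv_norm T 1 B"
      by (rule abs_le_max_deriv_norm[OF Ck_on_continuous[OF assms(10)] x]) simp
    show "\<bar>nth_deriv_within {0..T} 2 (\<lambda>x. B x $ r $ j) x\<bar> \<le> max_deriv_norm T 2 B"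
      by (rule abs_le_max_deriv_norm[OF Ck_on_continuous[OF assms(10)] x]) simp
  qed (use assms(2,5,11) in simp_all)
  \<comment> \<open>The dimension enters twice: here through the sum over \<open>r\<close>, and
    below through the square root of the number of entries in the Frobenius norm.\<close>
  have "\<bar>discretization_error h A B m $ i $ j\<bar> \<le> real CARD('n) * (T * h\<^sup>2 * ?K)" for i j
  proof -
    have "discretization_error h A B m $ i $ j = (\<Sum>r\<in>UNIV. ?E i r j)"
      unfolding discretization_error_def vector_minus_component discrete_conv_entry sum_subtractf
      by (simp add: stieltjes_conv_def)
    moreover have "\<bar>\<Sum>r\<in>UNIV. ?E i r j\<bar> \<le> (\<Sum>r\<in>(UNIV :: 'n set). T * h\<^sup>2 * ?K)"
      by (rule order_trans[OF sum_abs], rule sum_mono, rule summand)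
    ultimately show ?thesis by (simp only: sum_constant)
  qed
  then have "frobenius_norm (discretization_error h A B m) \<le> real CARD('n) * (real CARD('n) * (T * h\<^sup>2 * ?K))"
    by (rule frobenius_norm_le)
  then show ?thesis
    by (simp only: power2_eq_square mult.assoc)
qed

end
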